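(* Let $m,n\in\mathbb{N}$ and let $M$ be any one of the logics $\mathbf{NA}_{m,n}$, $\mathbf{N}^+\mathbf{A}_{m,n}$, $\mathbf{NRA}_{m,n}$. Let $\sharp,\flat:\mathscr{L}_\Box\to\mathscr{L}_p'$ be the translations associated with $M$ (defined in the context). Then $(\sharp,\flat)$ is a propositionalization of $M$ into classical propositional logic $\mathbf{Cl}$.
   Context: $\mathbb{N}$ includes $0$. Fix a countably infinite set $\mathrm{PropVar}$ of propositional variables. $\mathscr{L}_\Box$ is the set of formulas built from $\mathrm{PropVar}$ with $\land,\lor,\to,\bot,\Box$; $\top:=\bot\to\bot$, $\neg\varphi:=\varphi\to\bot$; $\Box^0\varphi:=\varphi$, $\Box^{k+1}\varphi:=\Box\Box^k\varphi$. Logics. $\mathbf{N}$ is classical propositional logic (tautologies in the language $\mathscr{L}_\Box$, modus ponens) plus the rule Nec: from $\varphi$ infer $\Box\varphi$. $\mathbf{NA}_{m,n}$ is $\mathbf{N}$ plus the axiom schema $\Box^n\varphi\to\Box^m\varphi$. $\mathbf{N}^+\mathbf{A}_{m,n}$ is $\mathbf{NA}_{m,n}$ plus the rule: from $\neg\Box\varphi$ infer $\neg\Box\Box\varphi$. $\mathbf{NRA}_{m,n}$ is $\mathbf{NA}_{m,n}$ plus the rule: from $\neg\varphi$ infer $\neg\Box\varphi$. (Rules apply to theorems.) Extended propositional language. For each $\varphi\in\mathscr{L}_\Box$ let $p_\varphi\notin\mathrm{PropVar}$ be a fresh variable (distinct for distinct $\varphi$); $\mathrm{PropVar}'=\mathrm{PropVar}\cup\{p_\varphi:\varphi\in\mathscr{L}_\Box\}$.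 $\mathscr{L}_p'$ is the set of formulas built from $\mathrm{PropVar}'$ with $\land,\lor,\to,\bot$, and $\mathbf{Cl}'$ is classical propositional logic in $\mathscr{L}_p'$. Positive and negative variables (on $\mathscr{L}_\Box$ and $\mathscr{L}_p'$). $\mathrm{V}^+(p)=\{p\}$, $\mathrm{V}^-(p)=\mathrm{V}^+(\bot)=\mathrm{V}^-(\bot)=\emptyset$ for every variable $p$; $\mathrm{V}^\bullet(\psi_1\to\psi_2)=\mathrm{V}^\circ(\psi_1)\cup\mathrm{V}^\bullet(\psi_2)$ for $(\bullet,\circ)\in\{(+,-),(-,+)\}$; $\mathrm{V}^\bullet(\psi_1\land\psi_2)=\mathrm{V}^\bullet(\psi_1\lor\psi_2)=\mathrm{V}^\bullet(\psi_1)\cup\mathrm{V}^\bullet(\psi_2)$; $\mathrm{V}^\bullet(\Box\psi)=\mathrm{V}^\bullet(\psi)$. Translations associated with $M$. $\varphi^\sharp,\varphi^\flat\in\mathscr{L}_p'$ are defined inductively for $\varphi\in\mathscr{L}_\Box$: - $\bot^\natural=\bot$, $p^\natural=p$, $(\psi_1\circledcirc\psi_2)^\natural=\psi_1^\natural\circledcirc\psi_2^\natural$ for $\natural\in\{\sharp,\flat\}$, $\circledcirc\in\{\land,\lor\}$; - $(\psi_1\to\psi_2)^\sharp=\psi_1^\flat\to\psi_2^\sharp$ and $(\psi_1\to\psi_2)^\flat=\psi_1^\sharp\to\psi_2^\flat$; - for $\Box^k\psi$ with $k\ge1$ and $\psi$ not of the form $\Box\chi$: $(\Box^k\psi)^\sharp=\top$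 if $M\vdash\Box^{k-1}\psi$; $(\Box^k\psi)^\sharp=p_{\Box^k\psi}\lor(\Box^{k-m+n}\psi)^\sharp$ if $M\nvdash\Box^{k-1}\psi$ and $k\ge m>n$; $(\Box^k\psi)^\sharp=p_{\Box^k\psi}$ otherwise. $(\Box^k\psi)^\flat=\bot$ if $C(k,\psi)$; $(\Box^k\psi)^\flat=p_{\Box^k\psi}\land(\Box^{k-n+m}\psi)^\flat$ if not $C(k,\psi)$ and $k\ge n>m$; $(\Box^k\psi)^\flat=p_{\Box^k\psi}$ otherwise. Here $C(k,\psi)$ holds exactly when either $M=\mathbf{N}^+\mathbf{A}_{m,n}$ (as the chosen case), $m=0$, $n\ge2$, $k\ge2$ and $\mathbf{N}^+\mathbf{A}_{m,n}\vdash\neg\Box^{k-1}\psi$; or $M=\mathbf{NRA}_{m,n}$ (as the chosen case) and $\mathbf{NRA}_{m,n}\vdash\neg\Box^{k-1}\psi$. Standard substitution. $\sigma^{\mathrm{S}}:\mathrm{PropVar}'\to\mathscr{L}_\Box$ is $\sigma^{\mathrm{S}}(p)=p$ for $p\in\mathrm{PropVar}$ and $\sigma^{\mathrm{S}}(p_\varphi)=\varphi$, extended to $\mathscr{L}_p'$ in the usual way. Propositionalization. A pair $(\sharp,\flat)$ of maps $\mathscr{L}_\Box\to\mathscr{L}_p'$ is a propositionalization of $M$ into $\mathbf{Cl}$ if for all $\varphi,\psi\in\mathscr{L}_\Box$: (1) $M\vdash\sigma^{\mathrm{S}}(\varphi^\sharp)\to\varphi$ and $M\vdash\varphi\to\sigma^{\mathrm{S}}(\varphi^\flat)$;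 (2) $M\vdash\varphi\to\psi$ implies $\mathbf{Cl}'\vdash\varphi^\flat\to\psi^\sharp$; (3) for $(\bullet,\circ)\in\{(+,-),(-,+)\}$ and $\natural\in\{\sharp,\flat\}$: (a) $p\in\mathrm{V}^\bullet(\varphi^\natural)\cap\mathrm{PropVar}$ implies $p\in\mathrm{V}^\bullet(\varphi)$; (b) $p_\psi\in\mathrm{V}^\bullet(\varphi^\natural)\setminus\mathrm{PropVar}$ implies $\mathrm{V}^\bullet(\psi)\subseteq\mathrm{V}^+(\varphi)$ and $\mathrm{V}^\circ(\psi)\subseteq\mathrm{V}^-(\varphi)$. *)

theory Defs
  imports "HOL-Library.Countable" "HOL-Library.Infinite_Typeclass"
begin

section \<open>The modal language and the logics\<close>

datatype 'v fm =
    Var 'v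
  | Bot
  | And "'v fm" "'v fm"
  | Or "'v fm" "'v fm"
  | Imp "'v fm" "'v fm"
  | Box "'v fm"

definition Neg :: "'v fm \<Rightarrow> 'v fm" where
  "Neg \<phi> = Imp \<phi> Bot"

definition boxes :: "nat \<Rightarrow> 'v fm \<Rightarrow> 'v fm" where
  "boxes k \<phi> = (Box ^^ k) \<phi>"

text \<open>Propositional evaluation of modal formulas: boxed formulas are treated as atoms, and
  their truth values are given by the second argument.\<close>

primrec eval :: "('v \<Rightarrow> bool) \<Rightarrow> ('v fm \<Rightarrow> bool) \<Rightarrow> 'v fm \<Rightarrow> bool" where
  "eval I B (Var p) \<longleftrightarrow> I p"
| "eval I B Bot \<longleftrightarrow> False"
| "eval I B (And \<phi> \<psi>) \<longleftrightarrow> eval I B \<phi> \<and> eval I B \<psi>"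
| "eval I B (Or \<phi> \<psi>) \<longleftrightarrow> eval I B \<phi> \<or> eval I B \<psi>"
| "eval I B (Imp \<phi> \<psi>) \<longleftrightarrow> (eval I B \<phi> \<longrightarrow> eval I B \<psi>)"
| "eval I B (Box \<phi>) \<longleftrightarrow> B \<phi>"

definition taut :: "'v fm \<Rightarrow> bool" where
  "taut \<phi> \<longleftrightarrow> (\<forall>I B. eval I B \<phi>)"

text \<open>The three families \<open>NA\<^sub>m\<^sub>,\<^sub>n\<close>, \<open>N\<^sup>+A\<^sub>m\<^sub>,\<^sub>n\<close> and \<open>NRA\<^sub>m\<^sub>,\<^sub>n\<close>. The family is kept as
  a separate tag because the translations below depend on the chosen presentation and not
  only on the set of theorems.\<close>

datatype family = NA | NplusA | NRA

inductive prov :: "family \<Rightarrow> nat \<Rightarrow> nat \<Rightarrow> 'v fm \<Rightarrow> bool"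
  for F :: family and m n :: nat where
  taut: "taut \<phi> \<Longrightarrow> prov F m n \<phi>"
| mp: "prov F m n (Imp \<phi> \<psi>) \<Longrightarrow> prov F m n \<phi> \<Longrightarrow> prov F m n \<psi>"
| nec: "prov F m n \<phi> \<Longrightarrow> prov F m n (Box \<phi>)"
| acc: "prov F m n (Imp (boxes n \<phi>) (boxes m \<phi>))"
| rosbox: "F = NplusA \<Longrightarrow> prov F m n (Neg (Box \<phi>)) \<Longrightarrow> prov F m n (Neg (Box (Box \<phi>)))"
| ros: "F = NRA \<Longrightarrow> prov F m n (Neg \<phi>) \<Longrightarrow> prov F m n (Neg (Box \<phi>))"


section \<open>The extended propositional language\<close>

text \<open>\<open>Fresh \<phi>\<close> is the variable \<open>p\<^sub>\<phi>\<close>.\<close>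

datatype 'v xvar = Orig 'v | Fresh "'v fm"

datatype 'w pfm =
    PVar 'w
  | PBot
  | PAnd "'w pfm" "'w pfm"
  | POr "'w pfm" "'w pfm"
  | PImp "'w pfm" "'w pfm"

definition PTop :: "'w pfm" where
  "PTop = PImp PBot PBot"

primrec peval :: "('w \<Rightarrow> bool) \<Rightarrow> 'w pfm \<Rightarrow> bool" where
  "peval I (PVar p) \<longleftrightarrow> I p"
| "peval I PBot \<longleftrightarrow> False"
| "peval I (PAnd \<phi> \<psi>) \<longleftrightarrow> peval I \<phi> \<and> peval I \<psi>"
| "peval I (POr \<phi> \<psi>) \<longleftrightarrow> peval I \<phi> \<or> peval I \<psi>"
| "peval I (PImp \<phi> \<psi>) \<longleftrightarrow> (peval I \<phi> \<longrightarrow> peval I \<psi>)"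

definition ptaut :: "'w pfm \<Rightarrow> bool" where
  "ptaut \<phi> \<longleftrightarrow> (\<forall>I. peval I \<phi>)"

inductive Cl :: "'w pfm \<Rightarrow> bool" where
  ptaut: "ptaut \<phi> \<Longrightarrow> Cl \<phi>"
| pmp: "Cl (PImp \<phi> \<psi>) \<Longrightarrow> Cl \<phi> \<Longrightarrow> Cl \<psi>"


section \<open>Positive and negative variables\<close>

datatype sign = Plus | Minus

fun opp :: "sign \<Rightarrow> sign" where
  "opp Plus = Minus"
| "opp Minus = Plus"

fun V :: "sign \<Rightarrow> 'v fm \<Rightarrow> 'v set" where
  "V s (Var p) = (if s = Plus then {p} else {})"
| "V s Bot = {}"
| "V s (And \<phi> \<psi>) = V s \<phi> \<union> V s \<psi>"
| "V s (Or \<phi> \<psi>) = V s \<phi> \<union> V s \<psi>"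
| "V s (Imp \<phi> \<psi>) = V (opp s) \<phi> \<union> V s \<psi>"
| "V s (Box \<phi>) = V s \<phi>"

fun PV :: "sign \<Rightarrow> 'w pfm \<Rightarrow> 'w set" where
  "PV s (PVar p) = (if s = Plus then {p} else {})"
| "PV s PBot = {}"
| "PV s (PAnd \<phi> \<psi>) = PV s \<phi> \<union> PV s \<psi>"
| "PV s (POr \<phi> \<psi>) = PV s \<phi> \<union> PV s \<psi>"
| "PV s (PImp \<phi> \<psi>) = PV (opp s) \<phi> \<union> PV s \<psi>"


section \<open>The translations\<close>

definition flat_bot :: "family \<Rightarrow> nat \<Rightarrow> nat \<Rightarrow> nat \<Rightarrow> 'v fm \<Rightarrow> bool" where
  "flat_bot F m n k \<psi> \<longleftrightarrow>
     (F = NplusA \<and> m = 0 \<and> n \<ge> 2 \<and> k \<ge> 2 \<and> prov NplusA m n (Neg (boxes (k - 1) \<psi>))) \<or>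
     (F = NRA \<and> prov NRA m n (Neg (boxes (k - 1) \<psi>)))"

definition is_Box :: "'v fm \<Rightarrow> bool" where
  "is_Box \<phi> \<longleftrightarrow> (\<exists>\<chi>. \<phi> = Box \<chi>)"

lemma boxes_0 [simp]: "boxes 0 \<phi> = \<phi>"
  by (simp add: boxes_def)

lemma boxes_Suc: "boxes (Suc k) \<phi> = Box (boxes k \<phi>)"
  by (simp add: boxes_def)

lemma size_boxes: "size (boxes k \<phi>) = k + size \<phi>"
  by (induction k) (simp_all add: boxes_Suc)

lemma boxes_cases:
  obtains k \<psi> where "\<phi> = boxes k \<psi>" "\<not> is_Box \<psi>"
proof -
  have "\<exists>k \<psi>. \<phi> = boxes k \<psi> \<and> \<not> is_Box \<psi>"
  proof (induction \<phi>)
    case (Box \<phi>)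
    then obtain k \<psi> where "\<phi> = boxes k \<psi>" "\<not> is_Box \<psi>" by blast
    then have "Box \<phi> = boxes (Suc k) \<psi>" by (simp add: boxes_Suc)
    with \<open>\<not> is_Box \<psi>\<close> show ?case by blast
  qed (rule exI[of _ 0], simp add: is_Box_def)+
  with that show thesis by blast
qed

lemma boxes_inject:
  "boxes k \<psi> = boxes l \<chi> \<Longrightarrow> \<not> is_Box \<psi> \<Longrightarrow> \<not> is_Box \<chi> \<Longrightarrow> k = l \<and> \<psi> = \<chi>"
proof (induction k arbitrary: l)
  case 0
  then show ?case by (cases l) (auto simp: boxes_Suc is_Box_def)
next
  case (Suc k)
  then show ?case by (cases l) (auto simp: boxes_Suc is_Box_def)
qed

lemma boxes_eq_iff:
  "\<not> is_Box \<psi> \<Longrightarrow> \<not> is_Box \<chi> \<Longrightarrow> boxes k \<psi> = boxes l \<chi> \<longleftrightarrow> k = l \<and> \<psi> = \<chi>"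
  using boxes_inject by blast

lemma boxes_eq_simps:
  assumes "k \<ge> 1"
  shows "boxes k \<psi> \<noteq> Var p" "boxes k \<psi> \<noteq> Bot" "boxes k \<psi> \<noteq> And \<phi> \<chi>"
    "boxes k \<psi> \<noteq> Or \<phi> \<chi>" "boxes k \<psi> \<noteq> Imp \<phi> \<chi>"
    "Var p \<noteq> boxes k \<psi>" "Bot \<noteq> boxes k \<psi>" "And \<phi> \<chi> \<noteq> boxes k \<psi>"
    "Or \<phi> \<chi> \<noteq> boxes k \<psi>" "Imp \<phi> \<chi> \<noteq> boxes k \<psi>"
  using assms by (cases k; simp add: boxes_Suc)+

lemma fm_boxes_exhaust:
  obtains p where "\<phi> = Var p" | "\<phi> = Bot"
  | \<psi> \<chi> where "\<phi> = And \<psi> \<chi>" | \<psi> \<chi> where "\<phi> = Or \<psi> \<chi>" | \<psi> \<chi> where "\<phi> = Imp \<psi> \<chi>"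
  | k \<psi> where "k \<ge> 1" "\<not> is_Box \<psi>" "\<phi> = boxes k \<psi>"
proof (cases "is_Box \<phi>")
  case True
  obtain k \<psi> where "\<phi> = boxes k \<psi>" "\<not> is_Box \<psi>" by (rule boxes_cases)
  moreover from this True have "k \<ge> 1" by (cases k) auto
  ultimately show thesis using that by blast
next
  case False
  then show thesis using that by (cases \<phi>) (auto simp: is_Box_def)
qed

function sharp :: "family \<Rightarrow> nat \<Rightarrow> nat \<Rightarrow> 'v fm \<Rightarrow> 'v xvar pfm"
  and flat :: "family \<Rightarrow> nat \<Rightarrow> nat \<Rightarrow> 'v fm \<Rightarrow> 'v xvar pfm"
where
  "sharp F m n (Var p) = PVar (Orig p)"
| "sharp F m n Bot = PBot"
| "sharp F m n (And \<phi> \<psi>) = PAnd (sharp F m n \<phi>) (sharp F m n \<psi>)"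
| "sharp F m n (Or \<phi> \<psi>) = POr (sharp F m n \<phi>) (sharp F m n \<psi>)"
| "sharp F m n (Imp \<phi> \<psi>) = PImp (flat F m n \<phi>) (sharp F m n \<psi>)"
| "k \<ge> 1 \<Longrightarrow> \<not> is_Box \<psi> \<Longrightarrow> sharp F m n (boxes k \<psi>) =
     (if prov F m n (boxes (k - 1) \<psi>) then PTop
      else if k \<ge> m \<and> m > n then
        POr (PVar (Fresh (boxes k \<psi>))) (sharp F m n (boxes (k - m + n) \<psi>))
      else PVar (Fresh (boxes k \<psi>)))"
| "flat F m n (Var p) = PVar (Orig p)"
| "flat F m n Bot = PBot"
| "flat F m n (And \<phi> \<psi>) = PAnd (flat F m n \<phi>) (flat F m n \<psi>)"
| "flat F m n (Or \<phi> \<psi>) = POr (flat F m n \<phi>) (flat F m n \<psi>)"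
| "flat F m n (Imp \<phi> \<psi>) = PImp (sharp F m n \<phi>) (flat F m n \<psi>)"
| "k \<ge> 1 \<Longrightarrow> \<not> is_Box \<psi> \<Longrightarrow> flat F m n (boxes k \<psi>) =
     (if flat_bot F m n k \<psi> then PBot
      else if k \<ge> n \<and> n > m then
        PAnd (PVar (Fresh (boxes k \<psi>))) (flat F m n (boxes (k - n + m) \<psi>))
      else PVar (Fresh (boxes k \<psi>)))"
  subgoal premises prems for P x
  proof (cases x)
    case (Inl a)
    obtain F m n \<phi> where "a = (F, m, n, \<phi>)" by (cases a)
    with Inl show ?thesis
      by (cases \<phi> rule: fm_boxes_exhaust) (simp_all add: prems(1-6))
  next
    case (Inr a)
    obtain F m n \<phi> where "a = (F, m, n, \<phi>)" by (cases a)
    with Inr show ?thesis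
      by (cases \<phi> rule: fm_boxes_exhaust) (simp_all add: prems(7-12))
  qed
  by (simp_all add: boxes_eq_simps boxes_eq_iff)
termination
  by (relation "measure (case_sum (\<lambda>(F, m, n, \<phi>). size \<phi>) (\<lambda>(F, m, n, \<phi>). size \<phi>))")
    (auto simp: size_boxes)


section \<open>Propositionalizations\<close>

primrec psubst :: "('w \<Rightarrow> 'v fm) \<Rightarrow> 'w pfm \<Rightarrow> 'v fm" where
  "psubst \<sigma> (PVar p) = \<sigma> p"
| "psubst \<sigma> PBot = Bot"
| "psubst \<sigma> (PAnd \<phi> \<psi>) = And (psubst \<sigma> \<phi>) (psubst \<sigma> \<psi>)"
| "psubst \<sigma> (POr \<phi> \<psi>) = Or (psubst \<sigma> \<phi>) (psubst \<sigma> \<psi>)"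
| "psubst \<sigma> (PImp \<phi> \<psi>) = Imp (psubst \<sigma> \<phi>) (psubst \<sigma> \<psi>)"

primrec std_subst :: "'v xvar \<Rightarrow> 'v fm" where
  "std_subst (Orig p) = Var p"
| "std_subst (Fresh \<phi>) = \<phi>"

text \<open>A logic is represented by its set of theorems, given as a predicate \<open>M\<close>.\<close>

definition propositionalization ::
  "('v fm \<Rightarrow> bool) \<Rightarrow> ('v fm \<Rightarrow> 'v xvar pfm) \<Rightarrow> ('v fm \<Rightarrow> 'v xvar pfm) \<Rightarrow> bool" where
  "propositionalization M sh fl \<longleftrightarrow>
     (\<forall>\<phi>. M (Imp (psubst std_subst (sh \<phi>)) \<phi>) \<and> M (Imp \<phi> (psubst std_subst (fl \<phi>)))) \<and>
     (\<forall>\<phi> \<psi>. M (Imp \<phi> \<psi>) \<longrightarrow> Cl (PImp (fl \<phi>) (sh \<psi>))) \<and>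
     (\<forall>\<phi> s. \<forall>tr \<in> {sh, fl}.
        (\<forall>p. Orig p \<in> PV s (tr \<phi>) \<longrightarrow> p \<in> V s \<phi>) \<and>
        (\<forall>\<psi>. Fresh \<psi> \<in> PV s (tr \<phi>) \<longrightarrow> V s \<psi> \<subseteq> V Plus \<phi> \<and> V (opp s) \<psi> \<subseteq> V Minus \<phi>))"

end

theory Submission
  imports Defs
begin

text \<open>Every formula is interpreted as a set of valuations of the extended propositional variables.
  The interpretation of \<open>\<box>\<^sup>k\<psi>\<close> copies the two translations, except that provability and refutability
  of \<open>\<box>\<^sup>k\<^sup>-\<^sup>1\<psi>\<close> are replaced by its being interpreted as the full or as the empty set, so that
  provability does not occur in the recursion. Theorems are interpreted as the full set, by
  induction on derivations. Moreover \<open>\<phi>\<^sup>\<flat>\<close> entails the interpretation of \<open>\<phi>\<close>, which in turn entails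
  \<open>\<phi>\<^sup>\<sharp>\<close>: in the induction step, a full interpretation of \<open>\<box>\<^sup>k\<^sup>-\<^sup>1\<psi>\<close> makes \<open>(\<box>\<^sup>k\<^sup>-\<^sup>1\<psi>)\<^sup>\<sharp>\<close> a tautology,
  hence \<open>\<box>\<^sup>k\<^sup>-\<^sup>1\<psi>\<close> a theorem by the first clause of propositionalization, and dually for an empty
  one. The second clause follows.\<close>

section \<open>Interpolation between a formula and its translations\<close>

lemma boxes_boxes: "boxes k (boxes j \<psi>) = boxes (k + j) \<psi>"
  by (simp add: boxes_def funpow_add)

text \<open>The translations pass from an iterated box to shorter iterates over the same unboxed
  formula, so the boxed case offers the hypothesis for all of these.\<close>

lemma boxes_induct [case_names Var Bot And Or Imp Boxes]:
  assumes "\<And>p. P (Var p)" "P Bot"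
    and "\<And>\<phi> \<psi>. P \<phi> \<Longrightarrow> P \<psi> \<Longrightarrow> P (And \<phi> \<psi>)"
    and "\<And>\<phi> \<psi>. P \<phi> \<Longrightarrow> P \<psi> \<Longrightarrow> P (Or \<phi> \<psi>)"
    and "\<And>\<phi> \<psi>. P \<phi> \<Longrightarrow> P \<psi> \<Longrightarrow> P (Imp \<phi> \<psi>)"
    and "\<And>k \<psi>. \<not> is_Box \<psi> \<Longrightarrow> (\<And>j. j \<le> k \<Longrightarrow> P (boxes j \<psi>)) \<Longrightarrow> P (boxes (Suc k) \<psi>)"
  shows "P \<phi>"
proof (induction "size \<phi>" arbitrary: \<phi> rule: less_induct)
  case less
  show ?case
  proof (cases \<phi> rule: fm_boxes_exhaust)
    case (6 k \<psi>)
    then obtain i where i: "k = Suc i" by (cases k) auto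
    have "P (boxes j \<psi>)" if "j \<le> i" for j
      using that less 6 i by (simp add: size_boxes)
    with 6 i assms(6) show ?thesis by blast
  qed (use less assms in auto)
qed

lemma prov_cut: "taut (Imp \<phi> \<psi>) \<Longrightarrow> prov F m n \<phi> \<Longrightarrow> prov F m n \<psi>"
  by (rule prov.mp[OF prov.taut])

lemma prov_cut2: "taut (Imp \<phi> (Imp \<psi> \<chi>)) \<Longrightarrow> prov F m n \<phi> \<Longrightarrow> prov F m n \<psi> \<Longrightarrow> prov F m n \<chi>"
  by (rule prov.mp[OF prov.mp[OF prov.taut]])

lemma prov_Imp_trans:
  "prov F m n (Imp \<phi> \<psi>) \<Longrightarrow> prov F m n (Imp \<psi> \<chi>) \<Longrightarrow> prov F m n (Imp \<phi> \<chi>)"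
  by (rule prov_cut2[rotated], assumption, assumption) (simp add: taut_def)

lemma prov_And_mono:
  "prov F m n (Imp \<phi> \<phi>') \<Longrightarrow> prov F m n (Imp \<psi> \<psi>') \<Longrightarrow> prov F m n (Imp (And \<phi> \<psi>) (And \<phi>' \<psi>'))"
  by (rule prov_cut2[rotated], assumption, assumption) (simp add: taut_def)

lemma prov_Or_mono:
  "prov F m n (Imp \<phi> \<phi>') \<Longrightarrow> prov F m n (Imp \<psi> \<psi>') \<Longrightarrow> prov F m n (Imp (Or \<phi> \<psi>) (Or \<phi>' \<psi>'))"
  by (rule prov_cut2[rotated], assumption, assumption) (simp add: taut_def)

lemma prov_Imp_mono:
  "prov F m n (Imp \<phi>' \<phi>) \<Longrightarrow> prov F m n (Imp \<psi> \<psi>') \<Longrightarrow> prov F m n (Imp (Imp \<phi> \<psi>) (Imp \<phi>' \<psi>'))"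
  by (rule prov_cut2[rotated], assumption, assumption) (simp add: taut_def)

text \<open>The axiom at \<open>boxes (i - n) \<psi>\<close>; the additive side condition avoids
  truncated subtraction and serves both \<open>m > n\<close> and \<open>n > m\<close>.\<close>

lemma prov_acc_boxes:
  assumes "n \<le> i" "j + n = i + m"
  shows "prov F m n (Imp (boxes i \<psi>) (boxes j \<psi>))"
proof -
  have "boxes i \<psi> = boxes n (boxes (i - n) \<psi>)" "boxes j \<psi> = boxes m (boxes (i - n) \<psi>)"
    using assms by (auto simp: boxes_boxes intro!: arg_cong[where f = "\<lambda>k. boxes k \<psi>"])
  then show ?thesis
    using prov.acc[of F m n "boxes (i - n) \<psi>"] by simp
qed

text \<open>The part of \<open>flat_bot\<close> free of provability, split off so that
  \<open>sem\<close> can pair it with emptiness in place of refutability.\<close>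

definition flat_bot_active :: "family \<Rightarrow> nat \<Rightarrow> nat \<Rightarrow> nat \<Rightarrow> bool" where
  "flat_bot_active F m n k \<longleftrightarrow> (F = NplusA \<and> m = 0 \<and> n \<ge> 2 \<and> k \<ge> 2) \<or> F = NRA"

lemma flat_bot_iff:
  "flat_bot F m n k \<psi> \<longleftrightarrow> flat_bot_active F m n k \<and> prov F m n (Neg (boxes (k - 1) \<psi>))"
  by (auto simp: flat_bot_def flat_bot_active_def)

lemma prov_Neg_boxes_if_flat_bot:
  assumes "flat_bot F m n (Suc k) \<psi>"
  shows "prov F m n (Neg (boxes (Suc k) \<psi>))"
proof (cases F)
  case NplusA
  \<comment> \<open>The bound \<open>k \<ge> 2\<close>, read at \<open>Suc k\<close>, makes the
    refuted formula start with a box, as \<open>rosbox\<close> requires.\<close>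
  with assms obtain j where "k = Suc j"
    by (cases k) (auto simp: flat_bot_iff flat_bot_active_def)
  with NplusA assms show ?thesis
    by (auto simp: flat_bot_iff boxes_Suc intro: prov.rosbox)
qed (use assms in \<open>auto simp: flat_bot_iff flat_bot_active_def boxes_Suc intro: prov.ros\<close>)

lemma translations_interpolate:
  "prov F m n (Imp (psubst std_subst (sharp F m n \<phi>)) \<phi>) \<and>
   prov F m n (Imp \<phi> (psubst std_subst (flat F m n \<phi>)))"
proof (induction \<phi> rule: boxes_induct)
  case (Boxes k \<psi>)
  let ?\<phi> = "boxes (Suc k) \<psi>"
  let ?s = "\<lambda>\<phi>. psubst std_subst (sharp F m n \<phi>)"
  let ?f = "\<lambda>\<phi>. psubst std_subst (flat F m n \<phi>)"
  have refl: "prov F m n (Imp ?\<phi> ?\<phi>)"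
    by (rule prov.taut) (simp add: taut_def)
  have "prov F m n (Imp (?s ?\<phi>) ?\<phi>)"
  proof (cases "prov F m n (boxes k \<psi>)")
    case True
    then have "prov F m n ?\<phi>"
      by (simp add: boxes_Suc prov.nec)
    then show ?thesis
      by (rule prov_cut[rotated]) (simp add: taut_def)
  next
    case False
    \<comment> \<open>The extra disjunct sits \<open>m - n\<close> boxes lower, so its induction
      hypothesis chains with the axiom.\<close>
    have "prov F m n (Imp (Or ?\<phi> (?s (boxes (Suc k - m + n) \<psi>))) ?\<phi>)" if "Suc k \<ge> m" "m > n"
    proof -
      have "prov F m n (Imp (?s (boxes (Suc k - m + n) \<psi>)) ?\<phi>)"
        using that by (intro prov_Imp_trans[OF Boxes(2)[THEN conjunct1] prov_acc_boxes]) auto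
      then show ?thesis
        by (rule prov_cut[rotated]) (simp add: taut_def)
    qed
    with False Boxes(1) refl show ?thesis by simp
  qed
  moreover have "prov F m n (Imp ?\<phi> (?f ?\<phi>))"
  proof (cases "flat_bot F m n (Suc k) \<psi>")
    case True
    with Boxes(1) show ?thesis
      using prov_Neg_boxes_if_flat_bot[OF True] by (simp add: Neg_def)
  next
    case False
    have "prov F m n (Imp ?\<phi> (And ?\<phi> (?f (boxes (Suc k - n + m) \<psi>))))" if "Suc k \<ge> n" "n > m"
    proof -
      have "prov F m n (Imp ?\<phi> (?f (boxes (Suc k - n + m) \<psi>)))"
        using that by (intro prov_Imp_trans[OF prov_acc_boxes Boxes(2)[THEN conjunct2]]) auto
      then show ?thesis
        by (rule prov_cut[rotated]) (simp add: taut_def)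
    qed
    with False Boxes(1) refl show ?thesis by simp
  qed
  ultimately show ?case ..
qed (simp_all add: prov_And_mono prov_Or_mono prov_Imp_mono prov.taut taut_def)

section \<open>Variable condition\<close>

lemma opp_opp [simp]: "opp (opp s) = s"
  by (cases s) auto

lemma V_boxes [simp]: "V s (boxes k \<psi>) = V s \<psi>"
  by (induction k) (simp_all add: boxes_Suc)

text \<open>Both signs are bundled because an implication swaps them on its antecedent.\<close>

definition vars_respected :: "'v fm \<Rightarrow> 'v xvar pfm \<Rightarrow> bool" where
  "vars_respected \<phi> \<alpha> \<longleftrightarrow> (\<forall>s.
     (\<forall>p. Orig p \<in> PV s \<alpha> \<longrightarrow> p \<in> V s \<phi>) \<and>
     (\<forall>\<psi>. Fresh \<psi> \<in> PV s \<alpha> \<longrightarrow> V s \<psi> \<subseteq> V Plus \<phi> \<and> V (opp s) \<psi> \<subseteq> V Minus \<phi>))"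

lemma vars_respected_And:
  "vars_respected \<phi> \<alpha> \<Longrightarrow> vars_respected \<psi> \<beta> \<Longrightarrow> vars_respected (And \<phi> \<psi>) (PAnd \<alpha> \<beta>)"
  unfolding vars_respected_def by (simp; blast)

lemma vars_respected_Or:
  "vars_respected \<phi> \<alpha> \<Longrightarrow> vars_respected \<psi> \<beta> \<Longrightarrow> vars_respected (Or \<phi> \<psi>) (POr \<alpha> \<beta>)"
  unfolding vars_respected_def by (simp; blast)

lemma vars_respected_Imp:
  assumes "vars_respected \<phi> \<alpha>" "vars_respected \<psi> \<beta>"
  shows "vars_respected (Imp \<phi> \<psi>) (PImp \<alpha> \<beta>)"
proof -
  have "V s \<chi> \<subseteq> V Minus \<phi> \<and> V (opp s) \<chi> \<subseteq> V Plus \<phi>" if "Fresh \<chi> \<in> PV (opp s) \<alpha>" for s \<chi>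
    using assms(1) that unfolding vars_respected_def by (metis opp_opp)
  with assms show ?thesis
    unfolding vars_respected_def by (auto; blast)
qed

lemma vars_respected_Fresh: "vars_respected \<phi> (PVar (Fresh \<phi>))"
  by (auto simp: vars_respected_def split: if_splits)

lemma vars_respected_same_V:
  "(\<And>s. V s \<phi> = V s \<psi>) \<Longrightarrow> vars_respected \<phi> \<alpha> \<longleftrightarrow> vars_respected \<psi> \<alpha>"
  by (simp add: vars_respected_def)

lemma translations_vars_respected:
  "vars_respected \<phi> (sharp F m n \<phi>) \<and> vars_respected \<phi> (flat F m n \<phi>)"
proof (induction \<phi> rule: boxes_induct)
  case (Boxes k \<psi>)
  let ?\<phi> = "boxes (Suc k) \<psi>"
  have "vars_respected ?\<phi> (sharp F m n (boxes j \<psi>)) \<and> vars_respected ?\<phi> (flat F m n (boxes j \<psi>))"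
    if "j \<le> k" for j
    using Boxes(2)[OF that] vars_respected_same_V[of ?\<phi> "boxes j \<psi>"] by simp
  then have "Suc k \<ge> m \<and> m > n \<longrightarrow> vars_respected ?\<phi> (sharp F m n (boxes (Suc k - m + n) \<psi>))"
    and "Suc k \<ge> n \<and> n > m \<longrightarrow> vars_respected ?\<phi> (flat F m n (boxes (Suc k - n + m) \<psi>))"
    by (auto simp del: add_diff_assoc2)
  with Boxes(1) vars_respected_Fresh[of ?\<phi>] show ?case
    by (auto simp: vars_respected_def PTop_def)
qed (simp_all add: vars_respected_And vars_respected_Or vars_respected_Imp,
    simp_all add: vars_respected_def)

section \<open>Interpretation by sets of valuations\<close>

text \<open>The union enforces the axiom for \<open>m > n\<close>, the intersection for
  \<open>n > m\<close>; at most one of them is active.\<close>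

function sem :: "family \<Rightarrow> nat \<Rightarrow> nat \<Rightarrow> 'v fm \<Rightarrow> ('v xvar \<Rightarrow> bool) set" where
  "sem F m n (Var p) = {v. v (Orig p)}"
| "sem F m n Bot = {}"
| "sem F m n (And \<phi> \<psi>) = sem F m n \<phi> \<inter> sem F m n \<psi>"
| "sem F m n (Or \<phi> \<psi>) = sem F m n \<phi> \<union> sem F m n \<psi>"
| "sem F m n (Imp \<phi> \<psi>) = - sem F m n \<phi> \<union> sem F m n \<psi>"
| "k \<ge> 1 \<Longrightarrow> \<not> is_Box \<psi> \<Longrightarrow> sem F m n (boxes k \<psi>) =
     ((if sem F m n (boxes (k - 1) \<psi>) = UNIV then UNIV
       else if flat_bot_active F m n k \<and> sem F m n (boxes (k - 1) \<psi>) = {} then {}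
       else {v. v (Fresh (boxes k \<psi>))})
      \<union> (if k \<ge> m \<and> m > n then sem F m n (boxes (k - m + n) \<psi>) else {}))
     \<inter> (if k \<ge> n \<and> n > m then sem F m n (boxes (k - n + m) \<psi>) else UNIV)"
  subgoal premises prems for P x
  proof -
    obtain F m n \<phi> where "x = (F, m, n, \<phi>)" by (cases x)
    then show ?thesis
      by (cases \<phi> rule: fm_boxes_exhaust) (simp_all add: prems)
  qed
  by (simp_all add: boxes_eq_simps boxes_eq_iff)
termination
  by (relation "measure (\<lambda>(F, m, n, \<phi>). size \<phi>)") (auto simp: size_boxes)

lemma sem_boxes_Suc:
  assumes "\<not> is_Box \<psi>"
  shows "sem F m n (boxes (Suc k) \<psi>) =
     ((if sem F m n (boxes k \<psi>) = UNIV then UNIV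
       else if flat_bot_active F m n (Suc k) \<and> sem F m n (boxes k \<psi>) = {} then {}
       else {v. v (Fresh (boxes (Suc k) \<psi>))})
      \<union> (if Suc k \<ge> m \<and> m > n then sem F m n (boxes (Suc k - m + n) \<psi>) else {}))
     \<inter> (if Suc k \<ge> n \<and> n > m then sem F m n (boxes (Suc k - n + m) \<psi>) else UNIV)"
  using sem.simps(6)[OF _ assms, of "Suc k" F m n] by simp

declare sem.simps(6) [simp del]

text \<open>At a fixed valuation, membership is propositional evaluation with boxed formulas as
  atoms; hence tautologies are full.\<close>

lemma mem_sem_iff_eval:
  "v \<in> sem F m n \<phi> \<longleftrightarrow> eval (\<lambda>p. v (Orig p)) (\<lambda>\<chi>. v \<in> sem F m n (Box \<chi>)) \<phi>"
  by (induction \<phi>) auto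

text \<open>For \<open>m < n\<close> the union is inactive, so the all-false valuation can enter a
  boxed level only if the level below is full.\<close>

lemma sem_UNIV_down:
  assumes "m < n" "\<not> is_Box \<psi>" "sem F m n (boxes k \<psi>) = UNIV" "j \<le> k"
  shows "sem F m n (boxes j \<psi>) = UNIV"
  using assms(4,3)
proof (induction rule: inc_induct)
  case (step i)
  then have "(\<lambda>_. False) \<in> sem F m n (boxes (Suc i) \<psi>)" by simp
  with assms(1) show ?case by (auto simp: sem_boxes_Suc[OF assms(2)] split: if_splits)
qed

text \<open>Dually, for \<open>n \<le> m\<close> the intersection is inactive, and the all-true
  valuation can be missing only if the level below is empty.\<close>

lemma sem_empty_down:
  assumes "n \<le> m" "\<not> is_Box \<psi>" "sem F m n (boxes k \<psi>) = {}" "j \<le> k"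
  shows "sem F m n (boxes j \<psi>) = {}"
  using assms(4,3)
proof (induction rule: inc_induct)
  case (step i)
  then have "(\<lambda>_. True) \<notin> sem F m n (boxes (Suc i) \<psi>)" by simp
  with assms(1) show ?case by (auto simp: sem_boxes_Suc[OF assms(2)] split: if_splits)
qed

text \<open>Only the intersection could spoil fullness, and it reaches down to a level that
  \<open>sem_UNIV_down\<close> makes full.\<close>

lemma sem_nec:
  assumes "sem F m n \<phi> = UNIV"
  shows "sem F m n (Box \<phi>) = UNIV"
proof -
  obtain k \<psi> where \<phi>: "\<phi> = boxes k \<psi>" and \<psi>: "\<not> is_Box \<psi>" by (rule boxes_cases)
  have "sem F m n (boxes (Suc k - n + m) \<psi>) = UNIV" if "Suc k \<ge> n" "n > m"
    by (rule sem_UNIV_down[where k = k]) (use assms \<phi> \<psi> that in auto)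
  with assms \<phi> have "sem F m n (boxes (Suc k) \<psi>) = UNIV"
    by (auto simp: sem_boxes_Suc[OF \<psi>])
  then show ?thesis by (simp add: \<phi> boxes_Suc)
qed

text \<open>One unfolding of the longer iterate exposes the shorter one as a united or an
  intersected set.\<close>

lemma sem_acc: "sem F m n (boxes n \<phi>) \<subseteq> sem F m n (boxes m \<phi>)"
proof -
  obtain k \<psi> where \<phi>: "\<phi> = boxes k \<psi>" and \<psi>: "\<not> is_Box \<psi>" by (rule boxes_cases)
  consider "m = n" | "m > n" | "n > m" by linarith
  then show ?thesis
  proof cases
    case 2
    with \<psi> have "sem F m n (boxes (m + k - m + n) \<psi>) \<subseteq> sem F m n (boxes (m + k) \<psi>)"
      by (subst (2) sem.simps) auto
    then show ?thesis by (simp add: \<phi> boxes_boxes add.commute)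
  next
    case 3
    with \<psi> have "sem F m n (boxes (n + k) \<psi>) \<subseteq> sem F m n (boxes (n + k - n + m) \<psi>)"
      by (subst sem.simps) auto
    then show ?thesis by (simp add: \<phi> boxes_boxes add.commute)
  qed simp
qed

text \<open>Only the union could add valuations, and it reaches down to a level that
  \<open>sem_empty_down\<close> makes empty.\<close>

lemma sem_ros:
  assumes "sem NRA m n \<phi> = {}"
  shows "sem NRA m n (Box \<phi>) = {}"
proof -
  obtain k \<psi> where \<phi>: "\<phi> = boxes k \<psi>" and \<psi>: "\<not> is_Box \<psi>" by (rule boxes_cases)
  have "sem NRA m n (boxes (Suc k - m + n) \<psi>) = {}" if "Suc k \<ge> m" "m > n"
    by (rule sem_empty_down[where k = k]) (use assms \<phi> \<psi> that in auto)
  with assms \<phi> \<psi> have "sem NRA m n (boxes (Suc k) \<psi>) = {}"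
    by (auto simp: sem_boxes_Suc[OF \<psi>] flat_bot_active_def)
  then show ?thesis by (simp add: \<phi> boxes_Suc)
qed

text \<open>Here \<open>flat_bot_active\<close> fails, so only the intersection could remove the
  all-true valuation. It is active only if \<open>m > 0\<close>, and then it refers to a shorter
  iterate that still has a box.\<close>

lemma True_mem_sem_boxes:
  assumes "0 < m \<or> n = 0" "\<not> is_Box \<psi>"
  shows "(\<lambda>_. True) \<in> sem NplusA m n (boxes (Suc k) \<psi>)"
proof (induction k rule: less_induct)
  case (less k)
  have "(\<lambda>_. True) \<in> sem NplusA m n (boxes (Suc k - n + m) \<psi>)" if "Suc k \<ge> n" "n > m"
  proof -
    from that assms(1) have "0 < Suc k - n + m" "Suc k - n + m < Suc k" by linarith+
    moreover from this(1) obtain j where j: "Suc k - n + m = Suc j"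
      by (elim gr0_implies_Suc[THEN exE])
    ultimately have "j < k" by linarith
    then show ?thesis unfolding j by (rule less)
  qed
  with assms(1) show ?case by (auto simp: sem_boxes_Suc[OF assms(2), of _ _ _ k] flat_bot_active_def)
qed

text \<open>By \<open>True_mem_sem_boxes\<close> the premise forces \<open>m = 0\<close> and
  \<open>n > 0\<close>.\<close>

lemma sem_rosbox:
  assumes "sem NplusA m n (Box \<phi>) = {}"
  shows "sem NplusA m n (Box (Box \<phi>)) = {}"
proof -
  obtain k \<psi> where \<phi>: "\<phi> = boxes k \<psi>" and \<psi>: "\<not> is_Box \<psi>" by (rule boxes_cases)
  have empty: "sem NplusA m n (boxes (Suc k) \<psi>) = {}"
    using assms by (simp add: \<phi> boxes_Suc)
  then have "\<not> (0 < m \<or> n = 0)"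
    using True_mem_sem_boxes[OF _ \<psi>] by blast
  then have m: "m = 0" and n: "n > 0" by auto
  have "sem NplusA m n (boxes (Suc (Suc k)) \<psi>) = {}"
  \<comment> \<open>For \<open>n = 1\<close> the intersection is with the empty level just below;
    for \<open>n \<ge> 2\<close> the clause guarded by \<open>flat_bot_active\<close> applies, since
    there are at least two boxes.\<close>
  proof (cases "n = 1")
    case True
    with m empty show ?thesis by (auto simp: sem_boxes_Suc[OF \<psi>, of _ _ _ "Suc k"])
  next
    case False
    with \<psi> m n empty show ?thesis by (auto simp: sem_boxes_Suc flat_bot_active_def)
  qed
  then show ?thesis by (simp add: \<phi> boxes_Suc)
qed

lemma sem_sound: "prov F m n \<phi> \<Longrightarrow> sem F m n \<phi> = UNIV"
proof (induction rule: prov.induct)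
  case (taut \<phi>)
  then show ?case by (auto simp: taut_def mem_sem_iff_eval[of _ F m n \<phi>])
next
  case (acc \<phi>)
  then show ?case using sem_acc[of F m n \<phi>] by auto
next
  case (ros \<phi>)
  then show ?case using sem_ros[of m n \<phi>] by (auto simp: Neg_def)
next
  case (rosbox \<phi>)
  then show ?case using sem_rosbox[of m n \<phi>] by (auto simp: Neg_def)
qed (simp_all add: sem_nec)

section \<open>Comparison with the translations\<close>

lemma eval_psubst: "eval I B (psubst \<sigma> \<alpha>) \<longleftrightarrow> peval (\<lambda>x. eval I B (\<sigma> x)) \<alpha>"
  by (induction \<alpha>) auto

lemma prov_psubst_if_ptaut: "ptaut \<alpha> \<Longrightarrow> prov F m n (psubst \<sigma> \<alpha>)"
  by (rule prov.taut) (simp add: taut_def ptaut_def eval_psubst)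

lemma prov_if_ptaut_sharp: "ptaut (sharp F m n \<phi>) \<Longrightarrow> prov F m n \<phi>"
  using translations_interpolate prov_psubst_if_ptaut by (blast intro: prov.mp)

lemma prov_Neg_if_ptaut_flat:
  assumes "ptaut (PImp (flat F m n \<phi>) PBot)"
  shows "prov F m n (Neg \<phi>)"
  using prov_psubst_if_ptaut[OF assms, of F m n std_subst]
  by (auto simp: Neg_def intro: prov_Imp_trans[OF translations_interpolate[THEN conjunct2]])

lemma translations_sandwich:
  "{v. peval v (flat F m n \<phi>)} \<subseteq> sem F m n \<phi> \<and> sem F m n \<phi> \<subseteq> {v. peval v (sharp F m n \<phi>)}"
proof (induction \<phi> rule: boxes_induct)
  case (Boxes k \<psi>)
  note IH = Boxes(2)
  have full: "prov F m n (boxes k \<psi>)" if "sem F m n (boxes k \<psi>) = UNIV"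
    using IH[of k] that by (intro prov_if_ptaut_sharp) (auto simp: ptaut_def)
  have empty: "prov F m n (Neg (boxes k \<psi>))" if "sem F m n (boxes k \<psi>) = {}"
    using IH[of k] that by (intro prov_Neg_if_ptaut_flat) (auto simp: ptaut_def)
  have sharp: "sem F m n (boxes (Suc k - m + n) \<psi>)
      \<subseteq> {v. peval v (sharp F m n (boxes (Suc k - m + n) \<psi>))}" if "Suc k \<ge> m" "m > n"
    using that by (intro IH[THEN conjunct2]) simp
  have flat: "{v. peval v (flat F m n (boxes (Suc k - n + m) \<psi>))}
      \<subseteq> sem F m n (boxes (Suc k - n + m) \<psi>)" if "Suc k \<ge> n" "n > m"
    using that by (intro IH[THEN conjunct1]) simp
  \<comment> \<open>If the empty clause of \<open>sem\<close> applied, \<open>empty\<close> would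
    give \<open>flat_bot\<close> and the flat translation would be \<open>PBot\<close>; otherwise
    the fresh variable suffices.\<close>
  have "v \<in> sem F m n (boxes (Suc k) \<psi>)" if "peval v (flat F m n (boxes (Suc k) \<psi>))" for v
    using that Boxes(1) empty flat by (auto simp: sem_boxes_Suc flat_bot_iff split: if_splits)
  \<comment> \<open>If the full clause of \<open>sem\<close> applies, \<open>full\<close> makes the
    sharp translation \<open>PTop\<close>.\<close>
  moreover have "peval v (sharp F m n (boxes (Suc k) \<psi>))" if "v \<in> sem F m n (boxes (Suc k) \<psi>)" for v
    using that Boxes(1) full sharp by (auto simp: sem_boxes_Suc PTop_def split: if_splits)
  ultimately show ?case by blast
qed auto

theorem theorem5p8:
  fixes F :: family and m n :: nat
  shows "propositionalization
    (prov F m n :: 'v::{countable,infinite} fm \<Rightarrow> bool) (sharp F m n) (flat F m n)"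
proof -
  have "Cl (PImp (flat F m n \<phi>) (sharp F m n \<psi>))" if "prov F m n (Imp \<phi> \<psi>)" for \<phi> \<psi> :: "'v fm"
  proof (rule Cl.ptaut)
    \<comment> \<open>This is the middle link between the flat translation of \<open>\<phi>\<close>
      and the sharp translation of \<open>\<psi>\<close>.\<close>
    have "sem F m n \<phi> \<subseteq> sem F m n \<psi>"
      using sem_sound[OF that] by auto
    then show "ptaut (PImp (flat F m n \<phi>) (sharp F m n \<psi>))"
      using translations_sandwich[of F m n \<phi>] translations_sandwich[of F m n \<psi>]
      by (auto simp: ptaut_def)
  qed
  moreover have "vars_respected \<phi> (tr \<phi>)" if "tr \<in> {sharp F m n, flat F m n}"
    for tr and \<phi> :: "'v fm"
    using that translations_vars_respected[of \<phi> F m n] by auto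
  ultimately show ?thesis
    using translations_interpolate[of F m n]
    unfolding propositionalization_def vars_respected_def by blast
qed

end
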